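(* Let $Y$ be a real random variable whose moment generating function $E[e^{tY}]$ exists for $|t|<r$, for some $r>0$, and let $(Y_j)_{j\ge 1}$ be mutually independent copies of $Y$. Then for any integers $n,m$ with $n\ge m\ge 0$, $$L_{Y}(n,m)=\frac{1}{m!}E\big[\triangle_{Y_{1},Y_{2},\dots,Y_{m}}\langle 0\rangle_{n}\big],$$ where $\triangle_{Y_1,\dots,Y_m}\langle 0\rangle_n$ denotes the value at $x=0$ of $\triangle_{Y_1,\dots,Y_m}$ applied to the function $x\mapsto\langle x\rangle_n$.
   Context: Rising factorial: $\langle x\rangle_0=1$, $\langle x\rangle_n=x(x+1)\cdots(x+n-1)$ for $n\ge 1$. Difference operators: for $y\in\mathbb{R}$, $\triangle_y f(x)=f(x+y)-f(x)$; for $(y_1,\dots,y_m)\in\mathbb{R}^m$, $\triangle_{y_1,\dots,y_m}f(x)=\triangle_{y_1}\circ\triangle_{y_2}\circ\cdots\circ\triangle_{y_m}f(x)$ (the identity operator when $m=0$). The probabilistic Lah numbers $L_Y(n,k)$ ($n\ge k\ge 0$) associated with $Y$ are defined by the power series expansion about $t=0$ $$\frac{1}{k!}\left(E\left[\left(\frac{1}{1-t}\right)^{Y}\right]-1\right)^{k}=\sum_{n=k}^{\infty}L_{Y}(n,k)\frac{t^{n}}{n!},\quad k\ge 0.$$ *)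

theory Defs
  imports "HOL-Probability.Probability"
begin

definition diff_op :: "real \<Rightarrow> (real \<Rightarrow> real) \<Rightarrow> real \<Rightarrow> real"
  where "diff_op y f = (\<lambda>x. f (x + y) - f x)"

definition diff_ops :: "real list \<Rightarrow> (real \<Rightarrow> real) \<Rightarrow> real \<Rightarrow> real"
  where "diff_ops ys = foldr (\<lambda>y g. diff_op y \<circ> g) ys id"

definition prob_Lah_gf :: "'a measure \<Rightarrow> ('a \<Rightarrow> real) \<Rightarrow> nat \<Rightarrow> real \<Rightarrow> real"
  where "prob_Lah_gf M Y k t =
    1 / fact k * ((\<integral>\<omega>. (1 / (1 - t)) powr Y \<omega> \<partial>M) - 1) ^ k"

text \<open>
  The coefficient sequence \<^term>\<open>a\<close> of the expansion is indexed by all naturals; requiring it to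
  vanish below \<^term>\<open>k\<close> encodes that the series starts at \<^term>\<open>n = k\<close>.
\<close>
definition prob_Lah :: "'a measure \<Rightarrow> ('a \<Rightarrow> real) \<Rightarrow> nat \<Rightarrow> nat \<Rightarrow> real"
  where "prob_Lah M Y n k =
    (THE a. (\<forall>j<k. a j = 0) \<and>
       (\<forall>\<^sub>F t in nhds 0. (\<lambda>j. a j * (t ^ j / fact j)) sums prob_Lah_gf M Y k t)) n"

end

theory Submission
  imports Defs "HOL-Computational_Algebra.Polynomial"
begin

text \<open>
  For \<open>\<bar>t\<bar> < 1\<close> the binomial series gives
  \<open>\<Sum>n. pochhammer x n * t ^ n / n! = (1 / (1 - t)) powr x\<close>. Applying the differences
  \<open>Y\<^sub>1, \<dots>, Y\<^sub>m\<close> in \<open>x\<close> at \<open>0\<close> turns the right-hand side into the product of the factors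
  \<open>(1 / (1 - t)) powr Y\<^sub>j - 1\<close>, whose expectation is \<open>m!\<close> times the generating function of the
  probabilistic Lah numbers, by independence. Expectation and series may be exchanged because the
  differenced series is dominated by \<open>2 ^ m * (\<Prod>j. (1 / (1 - \<bar>t\<bar>)) powr \<bar>Y\<^sub>j\<bar>)\<close>, which is
  integrable as soon as \<open>- ln (1 - \<bar>t\<bar>) < r\<close>. Comparing coefficients finishes the proof; those
  below \<open>m\<close> vanish since \<open>m\<close> differences annihilate polynomials of degree less than \<open>m\<close>.
\<close>

section \<open>Iterated differences\<close>

lemma diff_ops_Nil [simp]: "diff_ops [] f = f"
  by (simp add: diff_ops_def)

lemma diff_ops_Cons [simp]:
  "diff_ops (y # ys) f x = diff_ops ys f (x + y) - diff_ops ys f x"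
  by (simp add: diff_ops_def diff_op_def)

lemma diff_ops_mult_right: "diff_ops ys (\<lambda>x. f x * c) x = diff_ops ys f x * c"
  by (induction ys arbitrary: x) (simp_all add: algebra_simps)

lemma sums_diff_ops:
  assumes "\<And>x. (\<lambda>n. F n x) sums f x"
  shows "(\<lambda>n. diff_ops ys (F n) x) sums diff_ops ys f x"
  by (induction ys arbitrary: x) (auto intro: assms sums_diff)

text \<open>The function \<open>b powr x\<close> is an eigenfunction of each difference operator,
  with eigenvalue \<open>b powr y - 1\<close>.\<close>

lemma diff_ops_powr:
  "diff_ops ys (\<lambda>x. b powr x) x = b powr x * (\<Prod>y\<leftarrow>ys. b powr y - 1)"
  by (induction ys arbitrary: x) (simp_all add: powr_add algebra_simps)

text \<open>Unfolding the differences gives \<open>2 ^ length ys\<close> signed values of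
  \<open>f\<close>, at \<open>x\<close> plus partial sums of \<open>ys\<close>; monotonicity of
  \<open>g\<close> bounds them all at the largest possible absolute value of the argument.\<close>

lemma abs_diff_ops_le:
  assumes "\<And>x. \<bar>f x\<bar> \<le> g \<bar>x\<bar>" and "mono_on {0..} g"
  shows "\<bar>diff_ops ys f x\<bar> \<le> 2 ^ length ys * g (\<bar>x\<bar> + (\<Sum>y\<leftarrow>ys. \<bar>y\<bar>))"
proof (induction ys arbitrary: x)
  case Nil
  then show ?case using assms(1) by simp
next
  case (Cons y ys)
  let ?s = "\<Sum>y\<leftarrow>ys. \<bar>y\<bar>"
  have s: "?s \<ge> 0" by (intro sum_list_nonneg) auto
  have "g (\<bar>x + y\<bar> + ?s) \<le> g (\<bar>x\<bar> + (\<bar>y\<bar> + ?s))" "g (\<bar>x\<bar> + ?s) \<le> g (\<bar>x\<bar> + (\<bar>y\<bar> + ?s))"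
    using s by (auto intro!: mono_onD[OF assms(2)])
  then have "2 ^ length ys * g (\<bar>x + y\<bar> + ?s) \<le> 2 ^ length ys * g (\<bar>x\<bar> + (\<bar>y\<bar> + ?s))"
    "2 ^ length ys * g (\<bar>x\<bar> + ?s) \<le> 2 ^ length ys * g (\<bar>x\<bar> + (\<bar>y\<bar> + ?s))"
    by (auto intro: mult_left_mono)
  with Cons.IH[of "x + y"] Cons.IH[of x] have
    "\<bar>diff_ops (y # ys) f x\<bar> \<le> 2 * (2 ^ length ys * g (\<bar>x\<bar> + (\<bar>y\<bar> + ?s)))"
    unfolding diff_ops_Cons by linarith
  then show ?case by simp
qed

text \<open>A difference lowers the degree of a nonconstant polynomial and kills constants, so
  induction on the list applies with \<open>p\<close> generalised.\<close>

lemma diff_ops_poly_eq_0: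
  assumes "degree p < length ys"
  shows "diff_ops ys (poly p) x = 0"
  using assms
proof (induction ys arbitrary: p x)
  case (Cons y ys)
  define q where "q = pcompose p [:y, 1:] - p"
  \<comment> \<open>The head of the list is the outermost operator; it is moved innermost, where it
    turns \<open>p\<close> into \<open>q\<close>, so that the induction hypothesis fits.\<close>
  have lin: "diff_ops (y # ys) (poly p) x = diff_ops ys (poly q) x" for x
  proof -
    have "diff_ops zs (poly p) (z + y) - diff_ops zs (poly p) z = diff_ops zs (poly q) z" for zs z
    proof (induction zs arbitrary: z)
      case Nil
      then show ?case by (simp add: q_def poly_pcompose add.commute)
    next
      case (Cons z' zs)
      from Cons[of "z + z'"] Cons[of z] show ?case
        by (simp add: algebra_simps)
    qed
    then show ?thesis by simp
  qed
  show ?case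
  proof (cases "q = 0 \<or> degree p = 0")
    case True
    have "q = 0"
    proof (cases "degree p = 0")
      case True
      then show ?thesis by (auto simp: q_def elim!: degree_eq_zeroE)
    qed (use True in auto)
    moreover have "diff_ops zs (poly 0) z = 0" for zs z
      by (induction zs arbitrary: z) auto
    ultimately show ?thesis using lin by simp
  next
    case False
    have deg: "degree (pcompose p [:y, 1:]) = degree p"
      by (simp add: degree_pcompose)
    \<comment> \<open>A shift is monic of degree 1 and so keeps the leading coefficient, which
      therefore cancels in \<open>q\<close>.\<close>
    have "coeff (pcompose p [:y, 1:]) (degree p) = coeff p (degree p)"
      using lead_coeff_comp[of "[:y, 1:]" p] deg by simp
    then have "degree q < degree p"
      using False deg by (intro degree_less_if_less_eqI) (auto simp: q_def intro: degree_diff_le)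
    with Cons.prems show ?thesis
      unfolding lin by (intro Cons.IH) simp
  qed
qed simp

section \<open>Rising factorials and their generating function\<close>

lemma pochhammer_eq_poly:
  fixes x :: "'a::comm_ring_1"
  shows "pochhammer x n = poly (pochhammer [:0, 1:] n) x"
  by (induction n) (simp_all add: pochhammer_Suc algebra_simps)

lemma degree_pochhammer_X_le:
  "degree (pochhammer [:0, 1:] n :: 'a::comm_ring_1 poly) \<le> n"
proof (induction n)
  case (Suc n)
  have "degree ([:0, 1:] + of_nat n :: 'a poly) \<le> 1"
    by (intro degree_add_le) auto
  with Suc show ?case
    using degree_mult_le[of "pochhammer [:0, 1:] n :: 'a poly" "[:0, 1:] + of_nat n"]
    by (simp add: pochhammer_Suc)
qed simp

text \<open>The rising factorial of the polynomial variable \<open>[:0, 1:]\<close> supplies the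
  degree bound.\<close>

lemma diff_ops_pochhammer_eq_0:
  assumes "n < length ys"
  shows "diff_ops ys (\<lambda>x. pochhammer x n) x = 0"
proof -
  have "degree (pochhammer [:0, 1:] n :: real poly) < length ys"
    using degree_pochhammer_X_le[where 'a = real, of n] assms by linarith
  from diff_ops_poly_eq_0[OF this] show ?thesis
    by (simp add: pochhammer_eq_poly[where 'a = real])
qed

lemma pochhammer_nonneg':
  fixes x :: "'a::linordered_semidom"
  shows "x \<ge> 0 \<Longrightarrow> pochhammer x n \<ge> 0"
  by (simp add: pochhammer_prod prod_nonneg)

text \<open>Factor by factor, |x + k| \<le> |x| + k. Together with monotonicity this lets the rising
  factorial serve as its own majorant \<open>g\<close> in \<open>abs_diff_ops_le\<close>.\<close>

lemma abs_pochhammer_le: "\<bar>pochhammer (x::real) n\<bar> \<le> pochhammer \<bar>x\<bar> n"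
  by (induction n) (auto simp: pochhammer_Suc abs_mult pochhammer_nonneg' intro!: mult_mono)

lemma mono_on_pochhammer: "mono_on {0..} (\<lambda>x::real. pochhammer x n)"
proof (rule mono_onI)
  fix x y :: real
  assume "x \<in> {0..}" "y \<in> {0..}" "x \<le> y"
  then show "pochhammer x n \<le> pochhammer y n"
    by (auto simp: pochhammer_prod intro!: prod_mono)
qed

lemma pochhammer_sums_powr:
  fixes t x :: real
  assumes "\<bar>t\<bar> < 1"
  shows "(\<lambda>n. pochhammer x n * (t ^ n / fact n)) sums (1 / (1 - t)) powr x"
proof -
  \<comment> \<open>Negating both the exponent and the variable in the binomial series makes the two
    signs \<open>(-1) ^ n\<close> cancel.\<close>
  have "(-x gchoose n) * (-t) ^ n = pochhammer x n * (t ^ n / fact n)" for n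
    by (simp add: gbinomial_pochhammer power_minus[of t])
  moreover have "(1 + (-t)) powr (-x) = (1 / (1 - t)) powr x"
    using assms by (simp add: powr_minus_divide powr_divide)
  ultimately show ?thesis
    using gen_binomial_real[of "-t" "-x"] assms by simp
qed

section \<open>Uniqueness of the expansion\<close>

lemma powser_unique_nhds_0:
  fixes a b :: "nat \<Rightarrow> real"
  assumes "\<forall>\<^sub>F t in nhds 0. (\<lambda>n. a n * t ^ n) sums f t"
    and "\<forall>\<^sub>F t in nhds 0. (\<lambda>n. b n * t ^ n) sums f t"
  shows "a = b"
proof
  define d where "d = (\<lambda>n. a n - b n)"
  have "\<forall>\<^sub>F t in nhds 0. (\<lambda>n. d n * t ^ n) sums 0"
    using assms
  proof eventually_elim
    case (elim t)
    from sums_diff[OF this] show ?case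
      by (simp add: d_def left_diff_distrib)
  qed
  then obtain e where e: "e > 0" "\<And>t. dist t 0 < e \<Longrightarrow> (\<lambda>n. d n * t ^ n) sums 0"
    unfolding eventually_nhds_metric by blast
  have "d n = 0" for n
  proof (induction n rule: less_induct)
    case (less n)
    \<comment> \<open>With the lower coefficients zero, \<open>t ^ n\<close> can be divided out; the
      remaining series tends to its constant term \<open>d n\<close> as t tends to 0, yet is 0
      throughout.\<close>
    have "(\<lambda>k. d (k + n) * t ^ k) sums 0" if "t \<noteq> 0" "norm t < e" for t
    proof -
      have "(\<lambda>k. d (k + n) * t ^ (k + n)) sums 0"
        using sums_split_initial_segment[OF e(2)[of t], of n] that less by simp
      from sums_divide[OF this, of "t ^ n"] show ?thesis
        using that by (simp add: power_add)
    qed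
    from powser_limit_0_strong[OF e(1) this] show ?case
      by (simp add: tendsto_const_iff)
  qed
  then show "a n = b n" for n
    by (simp add: d_def)
qed

text \<open>Resolves the definite description: \<open>a\<close> is a witness, and power series
  uniqueness, with \<open>1 / fact j\<close> absorbed into the coefficients, excludes any
  other.\<close>

lemma prob_Lah_eqI:
  assumes "\<And>j. j < k \<Longrightarrow> a j = 0"
    and "\<forall>\<^sub>F t in nhds 0. (\<lambda>j. a j * (t ^ j / fact j)) sums prob_Lah_gf M Y k t"
  shows "prob_Lah M Y n k = a n"
proof -
  have "(THE a. (\<forall>j<k. a j = 0) \<and>
      (\<forall>\<^sub>F t in nhds 0. (\<lambda>j. a j * (t ^ j / fact j)) sums prob_Lah_gf M Y k t)) = a"
  proof (rule the_equality)
    fix b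
    assume "(\<forall>j<k. b j = 0) \<and>
      (\<forall>\<^sub>F t in nhds 0. (\<lambda>j. b j * (t ^ j / fact j)) sums prob_Lah_gf M Y k t)"
    then have "(\<lambda>j. b j / fact j) = (\<lambda>j. a j / fact j)"
      using assms(2) by (intro powser_unique_nhds_0[of _ "prob_Lah_gf M Y k"]) auto
    then have "b j / fact j = a j / fact j" for j
      by meson
    then show "b = a"
      by (simp add: fun_eq_iff)
  qed (use assms in auto)
  then show ?thesis
    by (simp add: prob_Lah_def)
qed

section \<open>Measurability, domination and integrability\<close>

lemma borel_measurable_diff_ops:
  assumes "f \<in> borel_measurable borel" and "X \<in> borel_measurable N"
    and "\<And>j. j \<in> set js \<Longrightarrow> Z j \<in> borel_measurable N"
  shows "(\<lambda>\<omega>. diff_ops (map (\<lambda>j. Z j \<omega>) js) f (X \<omega>)) \<in> borel_measurable N"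
  using assms(2,3)
proof (induction js arbitrary: X)
  case Nil
  then show ?case using assms(1) by simp
next
  case (Cons j js)
  \<comment> \<open>The recursion shifts the base point by a random amount, which is why the base
    point is a random variable \<open>X\<close>.\<close>
  have "(\<lambda>\<omega>. diff_ops (map (\<lambda>j. Z j \<omega>) js) f (X \<omega> + Z j \<omega>)) \<in> borel_measurable N"
    using Cons.prems by (intro Cons.IH borel_measurable_add) auto
  moreover have "(\<lambda>\<omega>. diff_ops (map (\<lambda>j. Z j \<omega>) js) f (X \<omega>)) \<in> borel_measurable N"
    using Cons.prems by (intro Cons.IH) auto
  ultimately show ?case by simp
qed

text \<open>One integrable bound on all absolute partial sums gives integrability of each term,
  pointwise absolute summability and summability of the L1 norms, as \<open>sums_integral\<close>
  requires.\<close>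

lemma sums_integral_dominated:
  fixes f :: "nat \<Rightarrow> 'a \<Rightarrow> real"
  assumes meas: "\<And>i. f i \<in> borel_measurable M"
    and G: "integrable M G"
    and bound: "\<And>n \<omega>. (\<Sum>i<n. \<bar>f i \<omega>\<bar>) \<le> G \<omega>"
    and sums: "\<And>\<omega>. (\<lambda>i. f i \<omega>) sums F \<omega>"
  shows "(\<lambda>i. \<integral>\<omega>. f i \<omega> \<partial>M) sums (\<integral>\<omega>. F \<omega> \<partial>M)"
proof -
  have le: "\<bar>f i \<omega>\<bar> \<le> G \<omega>" for i \<omega>
  proof -
    have "\<bar>f i \<omega>\<bar> \<le> (\<Sum>i<Suc i. \<bar>f i \<omega>\<bar>)"
      by (simp add: sum_nonneg)
    with bound[of \<omega> "Suc i"] show ?thesis by linarith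
  qed
  have int: "integrable M (f i)" for i
    by (rule Bochner_Integration.integrable_bound[OF G meas])
      (auto intro: order.trans[OF le abs_ge_self])
  have "summable (\<lambda>i. \<integral>\<omega>. norm (f i \<omega>) \<partial>M)"
  proof (rule summableI_nonneg_bounded)
    fix n
    have "(\<Sum>i<n. \<integral>\<omega>. norm (f i \<omega>) \<partial>M) = (\<integral>\<omega>. (\<Sum>i<n. norm (f i \<omega>)) \<partial>M)"
      using int by (intro Bochner_Integration.integral_sum[symmetric]) auto
    also have "\<dots> \<le> (\<integral>\<omega>. G \<omega> \<partial>M)"
      using int G bound by (intro integral_mono) auto
    finally show "(\<Sum>i<n. \<integral>\<omega>. norm (f i \<omega>) \<partial>M) \<le> (\<integral>\<omega>. G \<omega> \<partial>M)" .
  qed simp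
  moreover have "summable (\<lambda>i. norm (f i \<omega>))" for \<omega>
    using bound by (intro summableI_nonneg_bounded[of _ "G \<omega>"]) auto
  ultimately have "(\<lambda>i. \<integral>\<omega>. f i \<omega> \<partial>M) sums (\<integral>\<omega>. (\<Sum>i. f i \<omega>) \<partial>M)"
    using int by (intro sums_integral) auto
  then show ?thesis
    using sums by (simp add: sums_iff)
qed

text \<open>The bound on differences moves the evaluation to the sum of the |y|, where the binomial
  series at |t| can be resummed. The power then splits into one factor per entry, the form that
  independence can exploit.\<close>

lemma sum_abs_diff_ops_pochhammer_le:
  assumes "\<bar>t\<bar> < 1"
  shows "(\<Sum>i<n. \<bar>diff_ops ys (\<lambda>x. pochhammer x i) 0 * (t ^ i / fact i)\<bar>)
    \<le> 2 ^ length ys * (\<Prod>y\<leftarrow>ys. (1 / (1 - \<bar>t\<bar>)) powr \<bar>y\<bar>)"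
proof -
  let ?s = "\<Sum>y\<leftarrow>ys. \<bar>y\<bar>"
  have s: "?s \<ge> 0" by (intro sum_list_nonneg) auto
  have "(\<Sum>i<n. \<bar>diff_ops ys (\<lambda>x. pochhammer x i) 0 * (t ^ i / fact i)\<bar>)
    \<le> (\<Sum>i<n. 2 ^ length ys * (pochhammer ?s i * (\<bar>t\<bar> ^ i / fact i)))"
  proof (rule sum_mono)
    fix i
    have "\<bar>diff_ops ys (\<lambda>x. pochhammer x i) 0\<bar> \<le> 2 ^ length ys * pochhammer ?s i"
      using abs_diff_ops_le[OF abs_pochhammer_le mono_on_pochhammer, of ys i 0] by simp
    then have "\<bar>diff_ops ys (\<lambda>x. pochhammer x i) 0\<bar> * (\<bar>t\<bar> ^ i / fact i)
      \<le> 2 ^ length ys * pochhammer ?s i * (\<bar>t\<bar> ^ i / fact i)"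
      by (intro mult_right_mono) auto
    then show "\<bar>diff_ops ys (\<lambda>x. pochhammer x i) 0 * (t ^ i / fact i)\<bar>
      \<le> 2 ^ length ys * (pochhammer ?s i * (\<bar>t\<bar> ^ i / fact i))"
      by (simp add: abs_mult power_abs)
  qed
  also have "\<dots> = 2 ^ length ys * (\<Sum>i<n. pochhammer ?s i * (\<bar>t\<bar> ^ i / fact i))"
    by (simp only: sum_distrib_left)
  also have "\<dots> \<le> 2 ^ length ys * (1 / (1 - \<bar>t\<bar>)) powr ?s"
    using pochhammer_sums_powr[of "\<bar>t\<bar>" ?s] assms s
    by (intro mult_left_mono sum_le_suminf[THEN order.trans, OF _ _ _ eq_refl])
      (auto simp: sums_iff intro!: divide_nonneg_nonneg mult_nonneg_nonneg pochhammer_nonneg')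
  also have "(1 / (1 - \<bar>t\<bar>)) powr ?s = (\<Prod>y\<leftarrow>ys. (1 / (1 - \<bar>t\<bar>)) powr \<bar>y\<bar>)"
    using assms by (induction ys) (simp_all add: powr_add)
  finally show ?thesis .
qed

text \<open>Pointwise, \<open>exp (c * \<bar>y\<bar>)\<close> is one of \<open>exp (c * y)\<close>
  and \<open>exp (- c * y)\<close>, hence below their sum.\<close>

lemma integrable_exp_mult_abs:
  fixes Y :: "'a \<Rightarrow> real"
  assumes "Y \<in> borel_measurable M" and "\<bar>c\<bar> < r"
    and "\<And>t. \<bar>t\<bar> < r \<Longrightarrow> integrable M (\<lambda>\<omega>. exp (t * Y \<omega>))"
  shows "integrable M (\<lambda>\<omega>. exp (c * \<bar>Y \<omega>\<bar>))"
proof (rule Bochner_Integration.integrable_bound)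
  show "integrable M (\<lambda>\<omega>. exp (c * Y \<omega>) + exp (- c * Y \<omega>))"
    using assms(2) by (intro Bochner_Integration.integrable_add assms(3)) auto
  show "AE \<omega> in M. norm (exp (c * \<bar>Y \<omega>\<bar>)) \<le> norm (exp (c * Y \<omega>) + exp (- c * Y \<omega>))"
  proof (rule AE_I2)
    fix \<omega>
    show "norm (exp (c * \<bar>Y \<omega>\<bar>)) \<le> norm (exp (c * Y \<omega>) + exp (- c * Y \<omega>))"
      using exp_gt_zero[of "c * Y \<omega>"] exp_gt_zero[of "- c * Y \<omega>"]
      by (cases "Y \<omega> \<ge> 0") auto
  qed
qed (use assms(1) in measurable)

section \<open>Expectation of the differenced binomial series\<close>

theorem theorem2p2:
  fixes M :: "'a measure" and Y :: "'a \<Rightarrow> real"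
    and N :: "'b measure" and Ys :: "nat \<Rightarrow> 'b \<Rightarrow> real"
    and r :: real and n m :: nat
  assumes "prob_space M" and "Y \<in> borel_measurable M"
    and "r > 0" and "\<And>t. \<bar>t\<bar> < r \<Longrightarrow> integrable M (\<lambda>\<omega>. exp (t * Y \<omega>))"
    and "prob_space N" and "prob_space.indep_vars N (\<lambda>_. borel) Ys {1..}"
    and "\<And>j. j \<ge> 1 \<Longrightarrow> distr N borel (Ys j) = distr M borel Y"
    and "n \<ge> m"
  shows "prob_Lah M Y n m =
    1 / fact m *
      (\<integral>\<omega>. diff_ops (map (\<lambda>j. Ys j \<omega>) [1..<Suc m]) (\<lambda>x. pochhammer x n) 0 \<partial>N)"
proof -
  interpret M: prob_space M by fact
  interpret N: prob_space N by fact
  have Ys [measurable]: "Ys j \<in> borel_measurable N" if "j \<ge> 1" for j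
    using assms(6) that unfolding N.indep_vars_def by simp
  define ys where "ys = (\<lambda>\<omega>. map (\<lambda>j. Ys j \<omega>) [1..<Suc m])"
  define D where "D = (\<lambda>i \<omega>. diff_ops (ys \<omega>) (\<lambda>x. pochhammer x i) 0)"
  have len [simp]: "length (ys \<omega>) = m" for \<omega>
    by (simp add: ys_def)
  have prod_ys: "(\<Prod>y\<leftarrow>ys \<omega>. g y) = (\<Prod>j\<in>{1..m}. g (Ys j \<omega>))" for g :: "real \<Rightarrow> real" and \<omega>
    unfolding ys_def
    by (simp add: prod.distinct_set_conv_list[symmetric] comp_def
        atLeastLessThanSuc_atLeastAtMost del: upt_Suc)
  have poch [measurable]: "(\<lambda>x::real. pochhammer x i) \<in> borel_measurable borel" for i
    by (simp add: pochhammer_prod)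
  have D_meas [measurable]: "D i \<in> borel_measurable N" for i
    unfolding D_def ys_def by (intro borel_measurable_diff_ops poch) auto
  have indep: "N.indep_vars (\<lambda>_. borel) (\<lambda>j \<omega>. g (Ys j \<omega>)) {1..m}"
    if "g \<in> borel_measurable borel" for g :: "real \<Rightarrow> real"
    using that by (intro N.indep_vars_compose2[OF N.indep_vars_subset[OF assms(6)]]) auto
  \<comment> \<open>Both sides are statements about the common law of \<open>Ys j\<close> and
    \<open>Y\<close>.\<close>
  have int_iff: "integrable N (\<lambda>\<omega>. g (Ys j \<omega>)) \<longleftrightarrow> integrable M (\<lambda>\<omega>. g (Y \<omega>))"
    and int_eq: "(\<integral>\<omega>. g (Ys j \<omega>) \<partial>N) = (\<integral>\<omega>. g (Y \<omega>) \<partial>M)"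
    if g: "g \<in> borel_measurable borel" and j: "j \<ge> 1" for g :: "real \<Rightarrow> real" and j
    using integrable_distr_eq[OF Ys[OF j] g] integrable_distr_eq[OF assms(2) g]
      integral_distr[OF Ys[OF j] g] integral_distr[OF assms(2) g] assms(7)[OF j] by auto
  have ev: "\<forall>\<^sub>F t in nhds (0::real). \<bar>t\<bar> < 1 \<and> - ln (1 - \<bar>t\<bar>) < r"
  proof (intro eventually_conj)
    show "\<forall>\<^sub>F t in nhds (0::real). \<bar>t\<bar> < 1"
      by (intro order_tendstoD(2)[of _ 0]) (auto intro!: tendsto_eq_intros filterlim_ident)
    have "((\<lambda>t::real. - ln (1 - \<bar>t\<bar>)) \<longlongrightarrow> 0) (nhds 0)"
      by (auto intro!: tendsto_eq_intros filterlim_ident)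
    then show "\<forall>\<^sub>F t in nhds (0::real). - ln (1 - \<bar>t\<bar>) < r"
      using assms(3) by (rule order_tendstoD(2))
  qed
  have gf: "(\<lambda>i. (\<integral>\<omega>. D i \<omega> \<partial>N) * (t ^ i / fact i)) sums
      ((\<integral>\<omega>. (1 / (1 - t)) powr Y \<omega> \<partial>M) - 1) ^ m"
    if t: "\<bar>t\<bar> < 1" "- ln (1 - \<bar>t\<bar>) < r" for t :: real
  proof -
    have powr_abs: "(1 / (1 - \<bar>t\<bar>)) powr x = exp (- ln (1 - \<bar>t\<bar>) * x)" for x
      using t(1) by (simp add: powr_def ln_div)
    have powr_t: "(1 / (1 - t)) powr x = exp (- ln (1 - t) * x)" for x
      using t(1) by (simp add: powr_def ln_div)
    have ln_abs: "\<bar>- ln (1 - \<bar>t\<bar>)\<bar> < r"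
      using t by simp
    \<comment> \<open>Follows from 1 - |t| \<le> 1 - t \<le> 1 / (1 - |t|), whose second part is (1
      - t) (1 - |t|) \<le> 1; for negative t that product is 1 - t^2.\<close>
    have ln_t: "\<bar>- ln (1 - t)\<bar> < r"
    proof -
      have "ln (1 - \<bar>t\<bar>) \<le> ln (1 - t)"
        using t(1) by simp
      moreover have "ln (1 - t) \<le> - ln (1 - \<bar>t\<bar>)"
      proof -
        have "(1 - t) * (1 - \<bar>t\<bar>) \<le> 1"
        proof (cases "t \<ge> 0")
          case True
          then show ?thesis using t(1) by (intro mult_le_one) auto
        qed (auto simp: algebra_simps)
        then have "ln ((1 - t) * (1 - \<bar>t\<bar>)) \<le> ln 1"
          using t(1) by (subst ln_le_cancel_iff) auto
        then show ?thesis
          using t(1) by (simp add: ln_mult split: if_splits)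
      qed
      ultimately show ?thesis using t by linarith
    qed
    \<comment> \<open>By independence the product is integrable once each factor is, so the exponent
      stays below \<open>r\<close> for every \<open>m\<close>.\<close>
    have int_abs: "integrable N (\<lambda>\<omega>. \<Prod>j\<in>{1..m}. (1 / (1 - \<bar>t\<bar>)) powr \<bar>Ys j \<omega>\<bar>)"
    proof (rule N.indep_vars_integrable)
      fix j assume "j \<in> {1..m}"
      then show "integrable N (\<lambda>\<omega>. (1 / (1 - \<bar>t\<bar>)) powr \<bar>Ys j \<omega>\<bar>)"
        unfolding powr_abs
        using integrable_exp_mult_abs[OF assms(2) ln_abs assms(4)]
        by (subst int_iff[of "\<lambda>y. exp (- ln (1 - \<bar>t\<bar>) * \<bar>y\<bar>)"]) auto
    qed (use indep[of "\<lambda>y. (1 / (1 - \<bar>t\<bar>)) powr \<bar>y\<bar>"] in auto)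
    have int_t: "integrable M (\<lambda>\<omega>. (1 / (1 - t)) powr Y \<omega>)"
      unfolding powr_t by (rule assms(4)[OF ln_t])
    have "(\<lambda>i. \<integral>\<omega>. D i \<omega> * (t ^ i / fact i) \<partial>N) sums
        (\<integral>\<omega>. (\<Prod>j\<in>{1..m}. (1 / (1 - t)) powr Ys j \<omega> - 1) \<partial>N)"
    proof (rule sums_integral_dominated)
      show "integrable N (\<lambda>\<omega>. 2 ^ m * (\<Prod>j\<in>{1..m}. (1 / (1 - \<bar>t\<bar>)) powr \<bar>Ys j \<omega>\<bar>))"
        using int_abs by simp
      show "(\<Sum>i<k. \<bar>D i \<omega> * (t ^ i / fact i)\<bar>)
          \<le> 2 ^ m * (\<Prod>j\<in>{1..m}. (1 / (1 - \<bar>t\<bar>)) powr \<bar>Ys j \<omega>\<bar>)"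
        for k \<omega>
        using sum_abs_diff_ops_pochhammer_le[OF t(1), where ys = "ys \<omega>" and n = k]
        unfolding D_def prod_ys by simp
      show "(\<lambda>i. D i \<omega> * (t ^ i / fact i)) sums
          (\<Prod>j\<in>{1..m}. (1 / (1 - t)) powr Ys j \<omega> - 1)" for \<omega>
        \<comment> \<open>The leftover factor \<open>(1 / (1 - t)) powr 0\<close> is 1 because the
          base is nonzero; \<open>0 powr 0\<close> would be 0.\<close>
        using sums_diff_ops[where F = "\<lambda>i x. pochhammer x i * (t ^ i / fact i)",
            OF pochhammer_sums_powr[OF t(1)],
            where ys = "ys \<omega>" and x = 0] t(1)
        unfolding D_def diff_ops_mult_right diff_ops_powr prod_ys by (auto split: if_splits)
    qed simp
    also have "(\<integral>\<omega>. (\<Prod>j\<in>{1..m}. (1 / (1 - t)) powr Ys j \<omega> - 1) \<partial>N)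
      = (\<Prod>j\<in>{1..m}. \<integral>\<omega>. (1 / (1 - t)) powr Ys j \<omega> - 1 \<partial>N)"
    proof (rule N.indep_vars_lebesgue_integral)
      fix j assume "j \<in> {1..m}"
      then show "integrable N (\<lambda>\<omega>. (1 / (1 - t)) powr Ys j \<omega> - 1)"
        using int_t by (subst int_iff[of "\<lambda>y. (1 / (1 - t)) powr y - 1"]) auto
    qed (use indep[of "\<lambda>y. (1 / (1 - t)) powr y - 1"] in auto)
    also have "\<dots> = (\<Prod>j\<in>{1..m}. (\<integral>\<omega>. (1 / (1 - t)) powr Y \<omega> \<partial>M) - 1)"
    proof (rule prod.cong)
      fix j assume "j \<in> {1..m}"
      then have "(\<integral>\<omega>. (1 / (1 - t)) powr Ys j \<omega> - 1 \<partial>N) = (\<integral>\<omega>. (1 / (1 - t)) powr Y \<omega> - 1 \<partial>M)"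
        by (intro int_eq[of "\<lambda>y. (1 / (1 - t)) powr y - 1"]) auto
      also have "\<dots> = (\<integral>\<omega>. (1 / (1 - t)) powr Y \<omega> \<partial>M) - 1"
        using int_t by (simp add: M.prob_space)
      finally show "(\<integral>\<omega>. (1 / (1 - t)) powr Ys j \<omega> - 1 \<partial>N) = (\<integral>\<omega>. (1 / (1 - t)) powr Y \<omega> \<partial>M) - 1" .
    qed simp
    finally show ?thesis by simp
  qed
  have "prob_Lah M Y n m = 1 / fact m * (\<integral>\<omega>. D n \<omega> \<partial>N)"
  proof (rule prob_Lah_eqI)
    show "1 / fact m * (\<integral>\<omega>. D j \<omega> \<partial>N) = 0" if "j < m" for j
      using that by (simp add: D_def diff_ops_pochhammer_eq_0)
    show "\<forall>\<^sub>F t in nhds 0. (\<lambda>j. 1 / fact m * (\<integral>\<omega>. D j \<omega> \<partial>N) * (t ^ j / fact j))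
        sums prob_Lah_gf M Y m t"
      using ev
    proof eventually_elim
      case (elim t)
      then show ?case
        using sums_mult[OF gf[of t], of "1 / fact m"] by (simp add: prob_Lah_gf_def mult.assoc)
    qed
  qed
  then show ?thesis
    by (simp only: D_def ys_def)
qed

end
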